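(* Let $N_{\rm c}\ge 1$, let $\lambda_1,\dots,\lambda_{N_{\rm c}}\in\mathbb{C}$ be pairwise distinct, let $Q_1,\dots,Q_{N_{\rm c}}$ be nonzero complex numbers, and let $J\ge N_{\rm c}$. Set $M_p=\sum_{j=1}^{N_{\rm c}}Q_j\lambda_j^p$ for $p\ge 0$. Then the Hankel matrix $H_J(M)=(M_{r+s})_{r,s=0}^{J-1}$ satisfies $$\operatorname{rank}H_J(M)=N_{\rm c}.$$
   Context: Convention: $\lambda^0=1$ for every $\lambda$, including $\lambda=0$. In the application, the $\lambda_j=x_j-\mathrm{i}y_j$ are the phase nodes of $N_{\rm c}$ localized scattering components $D_j$ with phase centers $z_j=(x_j,y_j)\in\mathbb{R}^2$, $Q_j=\int_{D_j}q(y)\,\mathrm{d}y$ is the integrated contrast of the $j$-th component, and $M_p$ are the leading phase-center moments. *)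

theory Defs
  imports Complex_Main "Jordan_Normal_Form.DL_Rank"
begin

(* 0 ^ 0 = 1 in HOL, so a vanishing node contributes its weight to the moment of order 0. *)
definition moment :: "nat \<Rightarrow> (nat \<Rightarrow> complex) \<Rightarrow> (nat \<Rightarrow> complex) \<Rightarrow> nat \<Rightarrow> complex" where
  "moment Nc Q lam p = (\<Sum>j = 1..Nc. Q j * lam j ^ p)"

definition hankel_mat :: "nat \<Rightarrow> (nat \<Rightarrow> 'a) \<Rightarrow> 'a mat" where
  "hankel_mat J M = mat J J (\<lambda>(r, s). M (r + s))"

end

theory Submission
  imports Defs
begin

text \<open>
  The Hankel matrix of the moments factors as \<open>H = V D V\<^sup>T\<close>, where \<open>V\<close> is the \<open>J \<times> Nc\<close>
  Vandermonde matrix with entries \<open>\<lambda>\<^sub>j\<^sup>r\<close> and \<open>D\<close> is the diagonal matrix of the weights.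
  Both factors \<open>V\<close> and \<open>D V\<^sup>T\<close> have the full rank \<open>Nc\<close>, and this is witnessed by explicit
  one-sided inverses. Let row \<open>k\<close> of \<open>L\<close> hold the coefficients of the Lagrange polynomial that is
  \<open>1\<close> at the \<open>k\<close>-th node and \<open>0\<close> at the others. Its degree is below \<open>Nc \<le> J\<close>, so the
  coefficients fit in a row of length \<open>J\<close>, and multiplying that row with a column of \<open>V\<close>
  evaluates the polynomial at a node; hence \<open>L V = 1\<close> (\<open>vandermonde_left_inverse\<close>). Transposing,
  \<open>(D V\<^sup>T) (L\<^sup>T D\<^sup>-\<^sup>1) = D (L V)\<^sup>T D\<^sup>-\<^sup>1 = 1\<close>, where the weights must be nonzero. A product of a
  matrix with a left inverse and a matrix with a right inverse has as rank their common inner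
  dimension (\<open>rank_factorization\<close>), here \<open>Nc\<close>.
\<close>

lemma (in vec_space) col_space_mult_subset:
  assumes A: "A \<in> carrier_mat n m" and B: "B \<in> carrier_mat m k"
  shows "col_space (A * B) \<subseteq> col_space A"
proof
  fix y assume "y \<in> col_space (A * B)"
  then obtain x where x: "x \<in> carrier_vec k" and y: "y = (A * B) *\<^sub>v x"
    using A B by (auto simp: col_space_eq[of "A * B" k])
  have "y = A *\<^sub>v (B *\<^sub>v x)"
    using A B x y by simp
  then show "y \<in> col_space A"
    using A B x by (auto simp: col_space_eq[of A m])
qed

text \<open>
  The left inverse recovers a coefficient vector from its image, which separates the columns and
  excludes a linear relation between them. Distinctness is a step of its own because the rank is
  read off from the set of columns, which has \<open>m\<close> elements only if no column repeats.
\<close>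

lemma (in vec_space) rank_left_inverse:
  assumes A: "A \<in> carrier_mat n m" and L: "L \<in> carrier_mat m n"
    and LA: "L * A = 1\<^sub>m m"
  shows "rank A = m"
proof (rule lin_indpt_full_rank[OF A])
  show dist: "distinct (cols A)"
    unfolding distinct_conv_nth
  proof (intro allI impI notI)
    fix i j assume i: "i < length (cols A)" and j: "j < length (cols A)"
      and ij: "i \<noteq> j" and "cols A ! i = cols A ! j"
    with A have "col A i = col A j" by simp
    then have "col (L * A) i = col (L * A) j"
      using A L i j by simp
    then have "unit_vec m i = (unit_vec m j :: 'a vec)"
      using A i j by (simp add: LA)
    then show False
      using A i j ij by simp
  qed
  show "lin_indpt (set (cols A))"
  proof
    assume "lin_dep (set (cols A))"
    then obtain v where v: "v \<in> carrier_vec m" "v \<noteq> 0\<^sub>v m" "A *\<^sub>v v = 0\<^sub>v n"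
      using lin_depE[OF A _ dist] by blast
    have "v = (L * A) *\<^sub>v v" using v LA by simp
    also have "\<dots> = L *\<^sub>v (A *\<^sub>v v)" using A L v by simp
    also have "\<dots> = 0\<^sub>v m" using L v by (intro eq_vecI) auto
    finally show False using v by simp
  qed
qed

text \<open>
  The left inverse of \<open>A\<close> says that \<open>A\<close> has rank \<open>m\<close>. The right inverse \<open>R\<close> of \<open>B\<close> gives
  \<open>A = (A * B) * R\<close>, so \<open>A\<close> and \<open>A * B\<close> are right multiples of each other and share their column
  space.
\<close>

lemma (in vec_space) rank_factorization:
  assumes A: "A \<in> carrier_mat n m" and B: "B \<in> carrier_mat m k"
    and L: "L \<in> carrier_mat m n" and LA: "L * A = 1\<^sub>m m"
    and R: "R \<in> carrier_mat k m" and BR: "B * R = 1\<^sub>m m"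
  shows "rank (A * B) = m"
proof -
  have "A = (A * B) * R"
    using A BR by (simp add: assoc_mult_mat[OF A B R])
  then have "col_space A \<subseteq> col_space (A * B)"
    using col_space_mult_subset[of "A * B" k R m] A B R by simp
  then have "col_space (A * B) = col_space A"
    using col_space_mult_subset[OF A B] by blast
  then have "rank (A * B) = rank A"
    by (simp add: rank_def col_space_def)
  then show ?thesis
    using rank_left_inverse[OF A L LA] by simp
qed

text \<open>
  The product of the linear factors at the other nodes vanishes there and, since the nodes are
  distinct, not at \<open>x k\<close>; so it can be scaled to take the value \<open>1\<close> at \<open>x k\<close>.
\<close>

lemma lagrange_basis_poly:
  fixes x :: "nat \<Rightarrow> 'a :: field"
  assumes inj: "inj_on x {..<N}" and k: "k < N"
  obtains p where "degree p < N" and "\<And>j. j < N \<Longrightarrow> poly p (x j) = (if j = k then 1 else 0)"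
proof
  define r where "r = (\<Prod>i\<in>{..<N} - {k}. [:- x i, 1:])"
  have poly_r: "poly r y = (\<Prod>i\<in>{..<N} - {k}. y - x i)" for y
    by (simp add: r_def poly_prod)
  have nz: "poly r (x k) \<noteq> 0"
    using inj k by (auto simp: poly_r inj_on_def)
  have "degree r \<le> (\<Sum>i\<in>{..<N} - {k}. degree [:- x i, 1:])"
    unfolding r_def using degree_prod_sum_le[of "{..<N} - {k}" "\<lambda>i. [:- x i, 1:]"] by (simp add: o_def)
  also have "\<dots> < N" using k by simp
  finally show "degree (Polynomial.smult (inverse (poly r (x k))) r) < N"
    using degree_smult_le le_less_trans by blast
  fix j assume j: "j < N"
  show "poly (Polynomial.smult (inverse (poly r (x k))) r) (x j) = (if j = k then 1 else 0)"
    using nz j by (auto simp: poly_r)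
qed

lemma vandermonde_left_inverse:
  fixes x :: "nat \<Rightarrow> 'a :: field"
  assumes inj: "inj_on x {..<N}" and NJ: "N \<le> J"
  obtains L where "L \<in> carrier_mat N J" and "L * mat J N (\<lambda>(r, j). x j ^ r) = 1\<^sub>m N"
proof -
  have "\<exists>p. degree p < N \<and> (\<forall>j<N. poly p (x j) = (if j = k then 1 else 0))" if "k < N" for k
    using lagrange_basis_poly[OF inj that] by metis
  then obtain p where deg: "\<And>k. k < N \<Longrightarrow> degree (p k) < N"
    and val: "\<And>k j. k < N \<Longrightarrow> j < N \<Longrightarrow> poly (p k) (x j) = (if j = k then 1 else 0)"
    by metis
  define L where "L = mat N J (\<lambda>(k, r). coeff (p k) r)"
  have "(L * mat J N (\<lambda>(r, j). x j ^ r)) $$ (k, j) = (1\<^sub>m N :: 'a mat) $$ (k, j)"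
    if k: "k < N" and j: "j < N" for k j
  proof -
    have "(L * mat J N (\<lambda>(r, j). x j ^ r)) $$ (k, j) = (\<Sum>r = 0..<J. coeff (p k) r * x j ^ r)"
      using k j by (simp add: L_def scalar_prod_def)
    also have "\<dots> = (\<Sum>r\<le>degree (p k). coeff (p k) r * x j ^ r)"
      using deg[OF k] NJ by (intro sum.mono_neutral_right) (auto simp: coeff_eq_0)
    also have "\<dots> = poly (p k) (x j)"
      by (simp add: poly_altdef)
    finally show ?thesis
      using k j val by auto
  qed
  then have "L * mat J N (\<lambda>(r, j). x j ^ r) = 1\<^sub>m N"
    by (intro eq_matI) (auto simp: L_def)
  then show thesis
    using that[of L] by (simp add: L_def)
qed

theorem theorem2p2:
  fixes Nc J :: nat and lam Q :: "nat \<Rightarrow> complex"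
  assumes "1 \<le> Nc"
    and "inj_on lam {1..Nc}"
    and "\<And>j. j \<in> {1..Nc} \<Longrightarrow> Q j \<noteq> 0"
    and "Nc \<le> J"
  shows "vec_space.rank J (hankel_mat J (moment Nc Q lam)) = Nc"
proof -
  \<comment> \<open>Matrix indices start at 0, the nodes and weights at 1.\<close>
  define x q where "x j = lam (Suc j)" and "q j = Q (Suc j)" for j
  have "inj_on x {..<Nc}"
    unfolding x_def by (intro inj_onI) (use inj_onD[OF assms(2)] in fastforce)
  have q_nz: "q j \<noteq> 0" if "j < Nc" for j
    using assms(3)[of "Suc j"] that by (simp add: q_def)
  define V where "V = mat J Nc (\<lambda>(r, j). x j ^ r)"
  define E where "E = mat_diag Nc q * transpose_mat V"
  obtain L where L: "L \<in> carrier_mat Nc J" and LV: "L * V = 1\<^sub>m Nc"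
    unfolding V_def using vandermonde_left_inverse[OF \<open>inj_on x {..<Nc}\<close> assms(4)] .
  define G where "G = transpose_mat L * mat_diag Nc (\<lambda>j. inverse (q j))"
  have V: "V \<in> carrier_mat J Nc" by (simp add: V_def)
  have E: "E \<in> carrier_mat Nc J" unfolding E_def by (rule mult_carrier_mat[OF mat_diag_dim]) (use V in simp)
  have G: "G \<in> carrier_mat J Nc" unfolding G_def by (rule mult_carrier_mat[OF _ mat_diag_dim]) (use L in simp)
  have "V * E = hankel_mat J (moment Nc Q lam)"
  proof (rule eq_matI)
    fix r s assume "r < dim_row (hankel_mat J (moment Nc Q lam))"
      and "s < dim_col (hankel_mat J (moment Nc Q lam))"
    then have r: "r < J" and s: "s < J" by (auto simp: hankel_mat_def)
    have "(V * E) $$ (r, s) = (\<Sum>j = 0..<Nc. x j ^ r * (q j * x j ^ s))"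
      using r s V by (simp add: E_def mat_diag_mult_left[of _ Nc J] V_def scalar_prod_def)
    also have "\<dots> = (\<Sum>j = 1..Nc. Q j * lam j ^ (r + s))"
      by (rule sum.reindex_bij_witness[of _ "\<lambda>j. j - 1" Suc])
        (auto simp: x_def q_def power_add)
    finally show "(V * E) $$ (r, s) = hankel_mat J (moment Nc Q lam) $$ (r, s)"
      using r s by (simp add: hankel_mat_def moment_def)
  qed (use V E in \<open>auto simp: hankel_mat_def\<close>)
  moreover have "E * G = 1\<^sub>m Nc"
  proof -
    have VL: "transpose_mat V * transpose_mat L = 1\<^sub>m Nc"
      using transpose_mult[OF L V] LV by simp
    let ?D = "mat_diag Nc q" and ?D' = "mat_diag Nc (\<lambda>j. inverse (q j))"
    have VT: "transpose_mat V \<in> carrier_mat Nc J" and LT: "transpose_mat L \<in> carrier_mat J Nc"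
      using V L by simp_all
    have "E * G = ?D * (transpose_mat V * (transpose_mat L * ?D'))"
      unfolding E_def G_def
      by (rule assoc_mult_mat[OF mat_diag_dim VT mult_carrier_mat[OF LT mat_diag_dim]])
    also have "\<dots> = ?D * (transpose_mat V * transpose_mat L * ?D')"
      by (simp only: assoc_mult_mat[OF VT LT mat_diag_dim])
    also have "\<dots> = mat_diag Nc (\<lambda>j. q j * inverse (q j))"
      by (simp add: VL left_mult_one_mat[OF mat_diag_dim])
    also have "\<dots> = 1\<^sub>m Nc"
      using q_nz by (intro eq_matI) (auto simp: mat_diag_def)
    finally show ?thesis .
  qed
  ultimately show ?thesis
    using vec_space.rank_factorization[OF V E L LV G] by simp
qed

end
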